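(* Let $\{\mathbf e_n,\mathbf e_n^*\}_{n=1}^\infty$ be a seminormalized, complete biorthogonal system in the Banach space $\mathbb X$ and let $\eta=\{\eta(j)\}_{j=1}^\infty$ be a positive sequence. Then the following are equivalent: (i) $\|\mathbf 1^*_{\varepsilon A}\|_*\le\eta(|A|)$ for all finite $A\subset\mathbb N$ and all $\varepsilon\in\Upsilon$. (ii) $\mathbb X$ embeds into $m(\eta')$ via $\mathcal B=\{\mathbf e_n\}$ with norm $1$, where $\eta'=\{j/\eta(j)\}_{j=1}^\infty$; that is, $\|\{\mathbf e_j^*(x)\}_{j=1}^\infty\|_{m(\eta')}\le\|x\|$ for all $x\in\mathbb X$.
   Context: $(\mathbb X,\|\cdot\|)$ is a separable infinite-dimensional Banach space over $\mathbb K=\mathbb R$ or $\mathbb C$ with dual $(\mathbb X^*,\|\cdot\|_* )$. A system $\{\mathbf e_n,\mathbf e_n^*\}_{n=1}^\infty\subset\mathbb X\times\mathbb X^*$ is biorthogonal if $\mathbf e_n^*(\mathbf e_m)=\delta_{n,m}$; seminormalized if there are $A,B\in(0,\infty)$ with $A\le\|\mathbf e_n\|,\|\mathbf e_n^*\|_*\le B$ for all $n$; complete if the closed linear span of $\{\mathbf e_n\}$ is $\mathbb X$ (then $\mathbf e_n^*(x)\to0$ for every $x$). $\Upsilon$ is the set of sequences $\varepsilon=\{\varepsilon_j\}\subset\mathbb K$ with $|\varepsilon_j|=1$ for all $j$; $\mathbf 1^*_{\varepsilon A}=\sum_{j\in A}\varepsilon_j\mathbf e_j^*$. For a positive sequence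 $\nu$, the discrete weighted Marcinkiewicz space $m(\nu)$ consists of all $\mathbf s\in c_0$ with $\|\mathbf s\|_{m(\nu)}:=\sup_{k\in\mathbb N}\frac{\nu(k)}k\sum_{j=1}^ks_j^*<\infty$, where $\{s_j^*\}$ is the non-increasing rearrangement of $\{|s_n|\}$. *)

theory Defs
  imports "HOL-Analysis.Analysis"
begin

text \<open>
  Banach spaces over K = \<open>\<real>\<close> or \<open>\<complex>\<close>. The library class \<open>banach\<close> only provides the real
  structure, so the K-scalar multiplication is an explicit parameter. By the
  Gelfand--Mazur theorem, the instances of \<open>real_normed_field\<close> (whose norm is multiplicative)
  are exactly \<open>\<real>\<close> and \<open>\<complex>\<close>, up to isometric isomorphism.
\<close>

locale banach_space_over = vector_space scl
  for scl :: "'k::real_normed_field \<Rightarrow> 'a::banach \<Rightarrow> 'a" +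
  assumes norm_scl: "norm (scl c x) = norm c * norm x"
    and scl_of_real: "scl (of_real r) x = r *\<^sub>R x"

lemma banach_space_over_real: "banach_space_over (scaleR :: real \<Rightarrow> 'a::banach \<Rightarrow> 'a)"
  by unfold_locales (simp_all add: algebra_simps)

lemma banach_space_over_complex: "banach_space_over ((*) :: complex \<Rightarrow> complex \<Rightarrow> complex)"
  by unfold_locales (simp_all add: algebra_simps norm_mult scaleR_conv_of_real)

text \<open>
  The dual consists of the bounded K-linear functionals; its norm is the library's \<^const>\<open>onorm\<close>.
\<close>

definition dual_space ::
    "('k::real_normed_field \<Rightarrow> 'a::real_normed_vector \<Rightarrow> 'a) \<Rightarrow> ('a \<Rightarrow> 'k) set" where
  "dual_space scl = {f. Vector_Spaces.linear scl (*) f \<and> bounded_linear f}"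

definition biorthogonal_system ::
    "('k::real_normed_field \<Rightarrow> 'a::real_normed_vector \<Rightarrow> 'a) \<Rightarrow> (nat \<Rightarrow> 'a) \<Rightarrow> (nat \<Rightarrow> 'a \<Rightarrow> 'k) \<Rightarrow> bool" where
  "biorthogonal_system scl e e' \<longleftrightarrow>
     (\<forall>n. e' n \<in> dual_space scl) \<and> (\<forall>n m. e' n (e m) = (if n = m then 1 else 0))"

definition seminormalized ::
    "(nat \<Rightarrow> 'a::real_normed_vector) \<Rightarrow> (nat \<Rightarrow> 'a \<Rightarrow> 'k::real_normed_field) \<Rightarrow> bool" where
  "seminormalized e e' \<longleftrightarrow>
     (\<exists>A B. 0 < A \<and> 0 < B \<and>
        (\<forall>n. A \<le> norm (e n) \<and> norm (e n) \<le> B \<and> A \<le> onorm (e' n) \<and> onorm (e' n) \<le> B))"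

definition complete_system ::
    "('k::real_normed_field \<Rightarrow> 'a::real_normed_vector \<Rightarrow> 'a) \<Rightarrow> (nat \<Rightarrow> 'a) \<Rightarrow> bool" where
  "complete_system scl e \<longleftrightarrow> closure (module.span scl (range e)) = UNIV"

definition sign_sequences :: "(nat \<Rightarrow> 'k::real_normed_field) set" where
  "sign_sequences = {\<epsilon>. \<forall>j. norm (\<epsilon> j) = 1}"

definition signed_dual_sum ::
    "(nat \<Rightarrow> 'a \<Rightarrow> 'k::real_normed_field) \<Rightarrow> (nat \<Rightarrow> 'k) \<Rightarrow> nat set \<Rightarrow> 'a \<Rightarrow> 'k" where
  "signed_dual_sum e' \<epsilon> A = (\<lambda>x. \<Sum>j\<in>A. \<epsilon> j * e' j x)"

text \<open>
  The systems and the elements of \<open>c\<^sub>0\<close> are indexed from \<open>0\<close>, so \<open>rearrangement s j\<close> is the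
  \<open>(j + 1)\<close>-st largest of the numbers \<open>\<bar>s\<^sub>n\<bar>\<close>, given as usual through the distribution function
  of \<open>s\<close>. The weights \<open>\<nu>\<close>, on the other hand, are only used at indices \<open>k \<ge> 1\<close>, because there
  \<open>k\<close> counts the terms of a sum.
\<close>

definition rearrangement :: "(nat \<Rightarrow> 'k::real_normed_vector) \<Rightarrow> nat \<Rightarrow> real" where
  "rearrangement s j =
     Inf {t. 0 \<le> t \<and> finite {n. t < norm (s n)} \<and> card {n. t < norm (s n)} \<le> j}"

text \<open>
  Any reordering of \<open>\<bar>s\<bar>\<close> into a non-increasing sequence (which may omit zeros) yields
  \<open>rearrangement s\<close>.
\<close>

lemma rearrangement_eqI:
  fixes s :: "nat \<Rightarrow> 'k::real_normed_vector"
  assumes inj: "inj p" and supp: "{n. s n \<noteq> 0} \<subseteq> range p"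
    and dec: "decseq (\<lambda>j. norm (s (p j)))"
  shows "rearrangement s j = norm (s (p j))"
proof -
  let ?r = "\<lambda>i. norm (s (p i))"
  have "(finite {n. t < norm (s n)} \<and> card {n. t < norm (s n)} \<le> j) \<longleftrightarrow> ?r j \<le> t"
    if "0 \<le> t" for t
  proof -
    have eq: "{n. t < norm (s n)} = p ` {i. t < ?r i}"
    proof (intro subset_antisym subsetI)
      fix n assume n: "n \<in> {n. t < norm (s n)}"
      with that have "s n \<noteq> 0" by auto
      with supp have "n \<in> range p" by blast
      with n show "n \<in> p ` {i. t < ?r i}" by auto
    qed auto
    have inj': "inj_on p {i. t < ?r i}"
      using inj by (rule inj_on_subset) simp
    show ?thesis
    proof (cases "?r j \<le> t")
      case True
      then have sub: "{i. t < ?r i} \<subseteq> {..<j}"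
        using decseqD[OF dec] by (metis (no_types, lifting) lessThan_iff mem_Collect_eq not_less order.trans subsetI)
      from finite_subset[OF sub] card_mono[OF _ sub] True show ?thesis
        by (simp add: eq card_image[OF inj'])
    next
      case False
      then have sub: "{..j} \<subseteq> {i. t < ?r i}"
        using decseqD[OF dec] by (metis (no_types, lifting) atMost_iff mem_Collect_eq not_less order.trans subsetI)
      have "\<not> card {i. t < ?r i} \<le> j" if "finite {i. t < ?r i}"
        using card_mono[OF that sub] by simp
      with False show ?thesis
        by (auto simp: eq card_image[OF inj'] finite_image_iff[OF inj'])
    qed
  qed
  then have "{t. 0 \<le> t \<and> finite {n. t < norm (s n)} \<and> card {n. t < norm (s n)} \<le> j} = {?r j..}"
    by (auto intro: order_trans[OF norm_ge_zero])
  then show ?thesis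
    by (simp add: rearrangement_def)
qed

definition marcinkiewicz_norm :: "(nat \<Rightarrow> real) \<Rightarrow> (nat \<Rightarrow> 'k::real_normed_vector) \<Rightarrow> ereal" where
  "marcinkiewicz_norm \<nu> s =
     (SUP k\<in>{1..}. ereal (\<nu> k / real k * (\<Sum>j<k. rearrangement s j)))"

definition marcinkiewicz_space :: "(nat \<Rightarrow> real) \<Rightarrow> (nat \<Rightarrow> 'k::real_normed_vector) set" where
  "marcinkiewicz_space \<nu> = {s. s \<longlonglongrightarrow> 0 \<and> marcinkiewicz_norm \<nu> s < \<infinity>}"

definition embeds_into_marcinkiewicz_norm_1 ::
    "(nat \<Rightarrow> 'a::real_normed_vector \<Rightarrow> 'k::real_normed_field) \<Rightarrow> (nat \<Rightarrow> real) \<Rightarrow> bool" where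
  "embeds_into_marcinkiewicz_norm_1 e' \<nu> \<longleftrightarrow>
     (\<forall>x. (\<lambda>j. e' j x) \<in> marcinkiewicz_space \<nu> \<and>
          marcinkiewicz_norm \<nu> (\<lambda>j. e' j x) \<le> ereal (norm x))"

end

theory Submission
  imports Defs
begin

text \<open>
  If \<open>s\<close> tends to \<open>0\<close>, the sum of the first \<open>k\<close> terms of its rearrangement is the maximum over
  \<open>k\<close>-element sets \<open>A\<close> of \<open>\<Sum>n\<in>A. \<bar>s\<^sub>n\<bar>\<close>. For \<open>s\<^sub>n = e'\<^sub>n(x)\<close>, each such sum is in turn the maximum
  over sign sequences \<open>\<epsilon>\<close> of the absolute value of the functional \<open>\<Sum>n\<in>A. \<epsilon>\<^sub>n e'\<^sub>n\<close> at \<open>x\<close>.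
  Hence both conditions say that all these functionals are bounded by \<open>\<eta>(\<bar>A\<bar>) \<parallel>x\<parallel>\<close> at every \<open>x\<close>.
\<close>

section \<open>Decreasing enumeration of a null sequence\<close>

lemma null_sequence_max_norm_off_finite:
  fixes s :: "nat \<Rightarrow> 'k::real_normed_vector"
  assumes "s \<longlonglongrightarrow> 0" "finite F"
  obtains n where "n \<notin> F" "\<And>m. m \<notin> F \<Longrightarrow> norm (s m) \<le> norm (s n)"
proof (cases "\<forall>m. m \<notin> F \<longrightarrow> s m = 0")
  case True
  obtain n where "n \<notin> F"
    using ex_new_if_finite[OF infinite_UNIV_nat assms(2)] by blast
  with True that show ?thesis by fastforce
next
  case False
  then obtain m0 where m0: "m0 \<notin> F" "s m0 \<noteq> 0" by blast
  \<comment> \<open>A nonzero value off \<open>F\<close> serves as threshold: beyond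
    \<open>N\<close> all terms are smaller. Hence the maximum over the finite window
    \<open>?S\<close>, which contains \<open>m0\<close>, is a maximum off \<open>F\<close>.\<close>
  from m0 LIMSEQ_D[OF assms(1), of "norm (s m0)"]
  obtain N where N: "\<And>n. n \<ge> N \<Longrightarrow> norm (s n) < norm (s m0)" by auto
  have m0N: "m0 < N" using N[of m0] by (meson less_irrefl not_le)
  let ?S = "{..<N} - F"
  let ?M = "Max ((\<lambda>n. norm (s n)) ` ?S)"
  have "?M \<in> (\<lambda>n. norm (s n)) ` ?S"
    using m0 m0N by (intro Max_in) auto
  then obtain n where n: "n \<in> ?S" "?M = norm (s n)" by blast
  have le: "norm (s m) \<le> norm (s n)" if "m \<in> ?S" for m
    using that n(2) by (metis (mono_tags, lifting) Max_ge finite_Diff finite_imageI finite_lessThan imageI)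
  have "norm (s m) \<le> norm (s n)" if "m \<notin> F" for m
  proof (cases "m < N")
    case True
    with that le show ?thesis by simp
  next
    case False
    then have "norm (s m) < norm (s m0)" by (simp add: N)
    also have "norm (s m0) \<le> norm (s n)" using le m0 m0N by simp
    finally show ?thesis by simp
  qed
  with n that show ?thesis by blast
qed

text \<open>At each stage \<open>p\<close> picks a largest term among the indices not chosen
  before.\<close>

lemma null_sequence_greedy_enumeration:
  fixes s :: "nat \<Rightarrow> 'k::real_normed_vector"
  assumes "s \<longlonglongrightarrow> 0"
  obtains p :: "nat \<Rightarrow> nat" where "inj p"
    "\<And>k m. m \<notin> p ` {..<k} \<Longrightarrow> norm (s m) \<le> norm (s (p k))"
proof -
  let ?P = "\<lambda>f k n. n \<notin> f ` {..<k} \<and> (\<forall>m. m \<notin> f ` {..<k} \<longrightarrow> norm (s m) \<le> norm (s n))"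
  have "\<exists>p::nat \<Rightarrow> nat. \<forall>k::nat. ?P p k (p k)"
  \<comment> \<open>The choice at stage \<open>k\<close> may depend on all earlier ones; the first
    goal says that \<open>?P\<close> reads \<open>f\<close> only below \<open>k\<close>.\<close>
  proof (rule dependent_wellorder_choice)
    fix r :: nat and f g :: "nat \<Rightarrow> nat" and k :: nat
    assume "\<And>j. j < k \<Longrightarrow> f j = g j"
    then have "f ` {..<k} = g ` {..<k}" by (intro image_cong) auto
    then show "?P f k r = ?P g k r" by simp
  next
    fix k :: nat and f :: "nat \<Rightarrow> nat"
    show "\<exists>r. ?P f k r"
      by (rule null_sequence_max_norm_off_finite[OF assms, of "f ` {..<k}"]) auto
  qed
  then obtain p :: "nat \<Rightarrow> nat" where p: "\<And>k. ?P p k (p k)" by blast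
  have "p i \<noteq> p j" if "i < j" for i j
    using p[of j] that by (metis imageI lessThan_iff)
  then have "inj p" by (metis injI linorder_neqE_nat)
  with p that show ?thesis by blast
qed

text \<open>The greedy enumeration meets the hypotheses of \<open>rearrangement_eqI\<close>, which
  turns the distribution-function definition into an explicit sequence.\<close>

lemma null_sequence_decreasing_enumeration:
  fixes s :: "nat \<Rightarrow> 'k::real_normed_vector"
  assumes "s \<longlonglongrightarrow> 0"
  obtains p :: "nat \<Rightarrow> nat" where "inj p"
    "\<And>k m. m \<notin> p ` {..<k} \<Longrightarrow> norm (s m) \<le> norm (s (p k))"
    "decseq (\<lambda>j. norm (s (p j)))"
    "\<And>j. rearrangement s j = norm (s (p j))"
proof -
  obtain p :: "nat \<Rightarrow> nat" where p: "inj p"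
    "\<And>k m. m \<notin> p ` {..<k} \<Longrightarrow> norm (s m) \<le> norm (s (p k))"
    using null_sequence_greedy_enumeration[OF assms] by blast
  have dec: "decseq (\<lambda>j. norm (s (p j)))"
  proof (rule decseq_SucI)
    fix j
    have "p (Suc j) \<notin> p ` {..<j}" by (simp add: inj_image_mem_iff[OF p(1)])
    then show "norm (s (p (Suc j))) \<le> norm (s (p j))" by (rule p(2))
  qed
  have supp: "{n. s n \<noteq> 0} \<subseteq> range p"
  proof (rule subsetI, rule ccontr)
    fix n assume n: "n \<in> {n. s n \<noteq> 0}" "n \<notin> range p"
    then obtain N where N: "\<And>m. m \<ge> N \<Longrightarrow> norm (s m) < norm (s n)"
      using LIMSEQ_D[OF assms, of "norm (s n)"] by auto
    \<comment> \<open>An omitted \<open>n\<close> was available at every stage, so every chosen term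
      is at least as large. A null sequence has only finitely many such terms, yet \<open>p\<close>
      chooses infinitely many indices.\<close>
    have "norm (s n) \<le> norm (s (p j))" for j
      using n(2) by (intro p(2)) auto
    then have "p j < N" for j using N[of "p j"] by (meson not_le)
    then have "range p \<subseteq> {..<N}" by blast
    then show False using range_inj_infinite[OF p(1)] finite_subset by blast
  qed
  show ?thesis
    using p dec rearrangement_eqI[OF p(1) supp dec] by (intro that[of p]) auto
qed

text \<open>Exchange argument against the set \<open>B\<close> of the first \<open>k\<close> indices
  of \<open>p\<close>: after removing \<open>A \<inter> B\<close>, equally many indices remain on
  both sides, and \<open>t\<close> bounds the terms off \<open>B\<close> from above and those in
  \<open>B\<close> from below.\<close>

lemma sum_norm_le_sum_rearrangement:
  fixes s :: "nat \<Rightarrow> 'k::real_normed_vector"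
  assumes "s \<longlonglongrightarrow> 0" "finite A"
  shows "(\<Sum>n\<in>A. norm (s n)) \<le> (\<Sum>j<card A. rearrangement s j)"
proof -
  obtain p :: "nat \<Rightarrow> nat" where p: "inj p"
    "\<And>k m. m \<notin> p ` {..<k} \<Longrightarrow> norm (s m) \<le> norm (s (p k))"
    "decseq (\<lambda>j. norm (s (p j)))"
    "\<And>j. rearrangement s j = norm (s (p j))"
    using null_sequence_decreasing_enumeration[OF assms(1)] by blast
  define k where "k = card A"
  define B where "B = p ` {..<k}"
  define t where "t = norm (s (p k))"
  have inj: "inj_on p {..<k}" using p(1) by (rule inj_on_subset) simp
  have B: "finite B" "card B = k" by (simp_all add: B_def card_image[OF inj])
  have "card A = card (A \<inter> B) + card (A - B)" "card B = card (A \<inter> B) + card (B - A)"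
    using card_Int_Diff[OF assms(2), of B] card_Int_Diff[OF B(1), of A] by (simp_all add: Int_commute)
  then have card: "card (A - B) = card (B - A)" using B(2) k_def by simp
  have "(\<Sum>n\<in>A - B. norm (s n)) \<le> of_nat (card (A - B)) * t"
    unfolding t_def by (rule sum_bounded_above) (auto intro!: p(2) simp: B_def)
  also have "\<dots> = of_nat (card (B - A)) * t" by (simp add: card)
  also have "\<dots> \<le> (\<Sum>n\<in>B - A. norm (s n))"
    unfolding t_def B_def by (rule sum_bounded_below) (auto intro: decseqD[OF p(3)])
  finally have "(\<Sum>n\<in>A. norm (s n)) \<le> (\<Sum>n\<in>B. norm (s n))"
    using sum.Int_Diff[OF assms(2), of "\<lambda>n. norm (s n)" B]
      sum.Int_Diff[OF B(1), of "\<lambda>n. norm (s n)" A] by (simp add: Int_commute)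
  also have "\<dots> = (\<Sum>j<card A. rearrangement s j)"
    by (simp add: B_def sum.reindex[OF inj] p(4) flip: k_def)
  finally show ?thesis .
qed

text \<open>The first \<open>k\<close> indices of \<open>p\<close> work; by injectivity there are
  exactly \<open>k\<close>, even if fewer than \<open>k\<close> terms are nonzero.\<close>

lemma sum_rearrangement_attained:
  fixes s :: "nat \<Rightarrow> 'k::real_normed_vector"
  assumes "s \<longlonglongrightarrow> 0"
  obtains A where "finite A" "card A = k"
    "(\<Sum>j<k. rearrangement s j) = (\<Sum>n\<in>A. norm (s n))"
proof -
  obtain p :: "nat \<Rightarrow> nat" where p: "inj p" "\<And>j. rearrangement s j = norm (s (p j))"
    by (rule null_sequence_decreasing_enumeration[OF assms]) (rule that)
  have inj: "inj_on p {..<k}" using p(1) by (rule inj_on_subset) simp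
  show ?thesis
    by (rule that[of "p ` {..<k}"]) (simp_all add: card_image[OF inj] sum.reindex[OF inj] p(2))
qed

section \<open>Null coordinates from density of the span and uniform boundedness\<close>

lemma coordinates_tendsto_zero:
  fixes scl :: "'k::real_normed_field \<Rightarrow> 'a::banach \<Rightarrow> 'a"
  assumes "banach_space_over scl" "biorthogonal_system scl e e'"
    and "seminormalized e e'" "complete_system scl e"
  shows "(\<lambda>n. e' n x) \<longlonglongrightarrow> 0"
proof -
  interpret banach_space_over scl by fact
  have lin: "Vector_Spaces.linear scl (*) (e' n)" and bl: "bounded_linear (e' n)"
    and bi: "e' n (e m) = (if n = m then 1 else 0)" for n m
    using assms(2) by (auto simp: biorthogonal_system_def dual_space_def)
  obtain B where B: "0 < B" "\<And>n. onorm (e' n) \<le> B"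
    using assms(3) unfolding seminormalized_def by blast
  \<comment> \<open>By biorthogonality, adding a multiple of \<open>e m\<close> changes only
    coordinate \<open>m\<close>, so past \<open>m\<close> nothing is affected.\<close>
  have ev: "\<forall>\<^sub>F n in sequentially. e' n y = 0" if "y \<in> span (range e)" for y
  proof (rule span_induct_alt[OF that])
    show "\<forall>\<^sub>F n in sequentially. e' n 0 = 0"
      using linear_simps(3)[OF bl] by simp
  next
    fix c z y
    assume z: "z \<in> range e" and y: "\<forall>\<^sub>F n in sequentially. e' n y = 0"
    from z obtain m where z: "z = e m" by blast
    show "\<forall>\<^sub>F n in sequentially. e' n (scl c z + y) = 0"
      using y eventually_gt_at_top[of m]
    proof eventually_elim
      case (elim n)
      have "e' n (scl c z + y) = e' n (scl c z) + e' n y"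
        using linear_simps(1)[OF bl] by blast
      also have "e' n (scl c z) = c * e' n z"
        by (rule module_hom.scale[OF Vector_Spaces.linear.axioms(3)[OF lin]])
      finally show ?case using elim by (simp add: z bi)
    qed
  qed
  show ?thesis
  proof (rule LIMSEQ_I)
    fix r :: real assume r: "0 < r"
    have "x \<in> closure (span (range e))"
      using assms(4) by (simp add: complete_system_def)
    then obtain y where y: "y \<in> span (range e)" "dist y x < r / B"
      using r B(1) unfolding closure_approachable by (meson divide_pos_pos)
    obtain N where N: "\<And>n. n \<ge> N \<Longrightarrow> e' n y = 0"
      using ev[OF y(1)] unfolding eventually_sequentially by blast
    have "norm (e' n x - 0) < r" if "n \<ge> N" for n
    proof -
      \<comment> \<open>Since \<open>y\<close> has no coordinate at \<open>n\<close>, only the error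
        \<open>x - y\<close> counts; its size below \<open>r / B\<close> compensates the uniform
        bound \<open>B\<close> on the functionals.\<close>
      have "e' n x = e' n (x - y)"
        using linear_simps(2)[OF bl, of n x y] N[OF that] by simp
      then have "norm (e' n x) \<le> onorm (e' n) * norm (x - y)"
        using onorm[OF bl] by metis
      also have "\<dots> \<le> B * norm (x - y)"
        by (intro mult_right_mono B) simp
      also have "\<dots> < r"
        using y(2) B(1) by (simp add: dist_norm norm_minus_commute field_simps)
      finally show ?thesis by simp
    qed
    then show "\<exists>N. \<forall>n\<ge>N. norm (e' n x - 0) < r" by blast
  qed
qed

section \<open>Pointwise forms of the two conditions, and their equivalence\<close>

lemma marcinkiewicz_norm_le_iff:
  assumes "\<And>k. 1 \<le> k \<Longrightarrow> 0 < \<eta> k"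
  shows "marcinkiewicz_norm (\<lambda>j. real j / \<eta> j) s \<le> ereal c \<longleftrightarrow>
    (\<forall>k\<ge>1. (\<Sum>j<k. rearrangement s j) \<le> \<eta> k * c)"
proof -
  \<comment> \<open>The factor \<open>k\<close> in the weight cancels the averaging factor of the
    norm, leaving \<open>1 / \<eta> k\<close>.\<close>
  have "real k / \<eta> k / real k * S \<le> c \<longleftrightarrow> S \<le> \<eta> k * c" if "1 \<le> k" for k S
    using assms[OF that] that by (simp add: field_simps)
  then show ?thesis
    unfolding marcinkiewicz_norm_def SUP_le_iff by auto
qed

lemma norm_signed_dual_sum_le:
  assumes "\<epsilon> \<in> sign_sequences"
  shows "norm (signed_dual_sum e' \<epsilon> A x) \<le> (\<Sum>n\<in>A. norm (e' n x))"
proof -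
  have "norm (signed_dual_sum e' \<epsilon> A x) \<le> (\<Sum>n\<in>A. norm (\<epsilon> n * e' n x))"
    unfolding signed_dual_sum_def by (rule norm_sum)
  also have "\<dots> = (\<Sum>n\<in>A. norm (e' n x))"
    using assms by (simp add: sign_sequences_def norm_mult)
  finally show ?thesis .
qed

lemma signed_dual_sum_norm_attained:
  fixes e' :: "nat \<Rightarrow> 'a \<Rightarrow> 'k::real_normed_field"
  obtains \<epsilon> where "\<epsilon> \<in> sign_sequences"
    "\<And>A. norm (signed_dual_sum e' \<epsilon> A x) = (\<Sum>n\<in>A. norm (e' n x))"
proof -
  \<comment> \<open>The inverse phase makes every summand its own modulus, simultaneously for all
    \<open>A\<close>. The value 1 at vanishing coordinates keeps the modulus of
    \<open>\<epsilon> n\<close> equal to 1.\<close>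
  define \<epsilon> where "\<epsilon> n = (if e' n x = 0 then 1 else of_real (norm (e' n x)) / e' n x)" for n
  have "\<epsilon> \<in> sign_sequences"
    by (auto simp: sign_sequences_def \<epsilon>_def norm_divide)
  moreover have "norm (signed_dual_sum e' \<epsilon> A x) = (\<Sum>n\<in>A. norm (e' n x))" for A
  proof -
    have "\<epsilon> n * e' n x = of_real (norm (e' n x))" for n
      by (simp add: \<epsilon>_def)
    then have "signed_dual_sum e' \<epsilon> A x = of_real (\<Sum>n\<in>A. norm (e' n x))"
      by (simp add: signed_dual_sum_def)
    then show ?thesis by (simp add: sum_nonneg del: of_real_sum)
  qed
  ultimately show ?thesis by (rule that)
qed

theorem theorem1p3:
  fixes scl :: "'k::real_normed_field \<Rightarrow> 'a::banach \<Rightarrow> 'a"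
    and e :: "nat \<Rightarrow> 'a" and e' :: "nat \<Rightarrow> 'a \<Rightarrow> 'k" and \<eta> :: "nat \<Rightarrow> real"
  assumes "banach_space_over scl"
    and "separable_space (euclidean :: 'a topology)"
    and "\<not> (\<exists>B. finite_dimensional_vector_space scl B)"
    and "biorthogonal_system scl e e'"
    and "seminormalized e e'"
    and "complete_system scl e"
    and "\<And>j. 1 \<le> j \<Longrightarrow> 0 < \<eta> j"
  shows "(\<forall>A. finite A \<and> A \<noteq> {} \<longrightarrow>
            (\<forall>\<epsilon>\<in>sign_sequences. onorm (signed_dual_sum e' \<epsilon> A) \<le> \<eta> (card A)))
         \<longleftrightarrow> embeds_into_marcinkiewicz_norm_1 e' (\<lambda>j. real j / \<eta> j)"
proof -
  have null: "(\<lambda>n. e' n x) \<longlonglongrightarrow> 0" for x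
    using assms(1,4-6) by (rule coordinates_tendsto_zero)
  have bl: "bounded_linear (signed_dual_sum e' \<epsilon> A)" for \<epsilon> A
    using assms(4) unfolding signed_dual_sum_def biorthogonal_system_def dual_space_def
    by (intro bounded_linear_sum bounded_linear_const_mult) auto
  \<comment> \<open>For null sequences a real bound on the norm already gives membership, so the
    embedding reduces to its norm inequality.\<close>
  have "s \<in> marcinkiewicz_space \<nu>"
    if "s \<longlonglongrightarrow> 0" "marcinkiewicz_norm \<nu> s \<le> ereal c" for \<nu> c and s :: "nat \<Rightarrow> 'k"
    using that(1) le_less_trans[OF that(2), of \<infinity>] by (simp add: marcinkiewicz_space_def)
  then have "embeds_into_marcinkiewicz_norm_1 e' (\<lambda>j. real j / \<eta> j) \<longleftrightarrow>
      (\<forall>x. marcinkiewicz_norm (\<lambda>j. real j / \<eta> j) (\<lambda>n. e' n x) \<le> ereal (norm x))"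
    using null unfolding embeds_into_marcinkiewicz_norm_1_def by blast
  then have embeds: "embeds_into_marcinkiewicz_norm_1 e' (\<lambda>j. real j / \<eta> j) \<longleftrightarrow>
      (\<forall>x. \<forall>k\<ge>1. (\<Sum>j<k. rearrangement (\<lambda>n. e' n x) j) \<le> \<eta> k * norm x)"
    by (simp only: marcinkiewicz_norm_le_iff[OF assms(7)])
  show ?thesis
    unfolding embeds
  proof (intro iffI allI impI ballI)
    fix x k
    assume bound: "\<forall>A. finite A \<and> A \<noteq> {} \<longrightarrow>
        (\<forall>\<epsilon>\<in>sign_sequences. onorm (signed_dual_sum e' \<epsilon> A) \<le> \<eta> (card A))"
      and k: "1 \<le> (k::nat)"
    \<comment> \<open>For fixed \<open>x\<close> and \<open>k\<close>, first \<open>A\<close> and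
      then \<open>\<epsilon>\<close> are chosen extremal, so that one functional recovers the whole
      sum at \<open>x\<close>.\<close>
    obtain A where A: "finite A" "card A = k"
      "(\<Sum>j<k. rearrangement (\<lambda>n. e' n x) j) = (\<Sum>n\<in>A. norm (e' n x))"
      using sum_rearrangement_attained[OF null] by blast
    obtain \<epsilon> where \<epsilon>: "\<epsilon> \<in> sign_sequences"
      "\<And>A. norm (signed_dual_sum e' \<epsilon> A x) = (\<Sum>n\<in>A. norm (e' n x))"
      by (rule signed_dual_sum_norm_attained[of e' x]) (rule that)
    have "(\<Sum>j<k. rearrangement (\<lambda>n. e' n x) j) = norm (signed_dual_sum e' \<epsilon> A x)"
      by (simp add: A(3) \<epsilon>(2))
    also have "\<dots> \<le> onorm (signed_dual_sum e' \<epsilon> A) * norm x"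
      by (rule onorm[OF bl])
    also have "\<dots> \<le> \<eta> k * norm x"
    proof (rule mult_right_mono)
      have "A \<noteq> {}" using A(2) k by auto
      then show "onorm (signed_dual_sum e' \<epsilon> A) \<le> \<eta> k"
        using bound A(1,2) \<epsilon>(1) by blast
    qed simp
    finally show "(\<Sum>j<k. rearrangement (\<lambda>n. e' n x) j) \<le> \<eta> k * norm x" .
  next
    fix A :: "nat set" and \<epsilon> :: "nat \<Rightarrow> 'k"
    assume bound: "\<forall>x. \<forall>k\<ge>1. (\<Sum>j<k. rearrangement (\<lambda>n. e' n x) j) \<le> \<eta> k * norm x"
      and A: "finite A \<and> A \<noteq> {}" and \<epsilon>: "\<epsilon> \<in> sign_sequences"
    have card: "1 \<le> card A" using A by (simp add: Suc_le_eq card_gt_0_iff)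
    show "onorm (signed_dual_sum e' \<epsilon> A) \<le> \<eta> (card A)"
    proof (rule onorm_bound)
      \<comment> \<open>Positivity of \<open>\<eta>\<close> is assumed only from index 1 on, so this
        uses that \<open>A\<close> is nonempty.\<close>
      show "0 \<le> \<eta> (card A)" using assms(7)[OF card] by simp
      fix x
      have "norm (signed_dual_sum e' \<epsilon> A x) \<le> (\<Sum>n\<in>A. norm (e' n x))"
        using \<epsilon> by (rule norm_signed_dual_sum_le)
      also have "\<dots> \<le> (\<Sum>j<card A. rearrangement (\<lambda>n. e' n x) j)"
        using null A by (intro sum_norm_le_sum_rearrangement) auto
      also have "\<dots> \<le> \<eta> (card A) * norm x" using bound card by blast
      finally show "norm (signed_dual_sum e' \<epsilon> A x) \<le> \<eta> (card A) * norm x" .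
    qed
  qed
qed

end
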